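(* Let $m\ge 1$ and, for each $d\in\{1,\dots,m\}$, let $m_d>0$ be an integer, $N(d)_{x_d}$, $M(d)_{x_d}$ and $L_d$ operators, $A_d(t)$, $\lambda_d(t)$ functions of $t$, and $\omega_d^{(0)}(x_d),\dots,\omega_d^{(m_d)}(x_d)$ functions of $x_d$. Consider the equations, for $u=u(x_1,\dots,x_m,t)$, $$(a)\quad \mathcal{O}_tu-\sum_{d=1}^{m}A_d(t)\,M(d)_{x_d}\big(uL_d(u)\big)=\Big(\sum_{d=1}^{m}N(d)_{x_d}M(d)_{x_d}\Big)u+\Big(\sum_{d=1}^{m}A_d(t)\Big)u,$$ $$(b)\quad \mathcal{O}_tu-\sum_{d=1}^{m}A_d(t)\,N(d)_{x_d}\big(uL_d(u)\big)=\Big(\sum_{d=1}^{m}N(d)_{x_d}M(d)_{x_d}\Big)u+\Big(\sum_{d=1}^{m}A_d(t)\Big)u.$$ Assume that for each $d\in\{1,\dots,m\}$: (i) $N(d)_{x_d}$ and $M(d)_{x_d}$ satisfy the Leibniz rule with respect to $x_d$; (ii) in case (a): $M(d)_{x_d}(\omega_d^{(l)})=1$ for all $l\neq0$ and $M(d)_{x_d}(\omega_d^{(0)})=0$; in case (b): $N(d)_{x_d}(\omega_d^{(l)})=M(d)_{x_d}(\omega_d^{(l)})=1$ for all $l\ne0$ and $N(d)_{x_d}(\omega_d^{(0)})=M(d)_{x_d}(\omega_d^{(0)})=0$; (iii) $L_d\big(\omega_{d'}^{(l)}(x_{d'})\big)=\lambda_d(t)\,\omega_{d'}^{(l)}(x_{d'})$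 for all $d'\in\{1,\dots,m\}$ and all $l\in\{0,\dots,m_{d'}\}$. If the functions $b_d^{(l_d)}(t)$ satisfy the system $$\mathcal{O}_t\big(b_d^{(l_d)}(t)\big)=b_d^{(l_d)}(t)\Big[\sum_{d'=1}^{m}2A_{d'}(t)\lambda_{d'}(t)\Big(\sum_{l_{d'}=1}^{m_{d'}}b_{d'}^{(l_{d'})}(t)\Big)+\sum_{d'=1}^{m}A_{d'}(t)\Big]$$ for all $d\in\{1,\dots,m\}$ and all $l_d\in\{0,\dots,m_d\}$, then $$u(x_1,\dots,x_m,t)=\sum_{d=1}^{m}\sum_{l_d=0}^{m_d}b_d^{(l_d)}(t)\,\omega_d^{(l_d)}(x_d)$$ is a solution of the equation (respectively (a) or (b)).
   Context: $u$ is a scalar function of $m$ spatial variables $x_1,\dots,x_m$ and of $t$. $\mathcal{O}_t$ is a linear differential operator acting only on the variable $t$ (so $\mathcal{O}_t(b(t)\omega(x))=\omega(x)\,\mathcal{O}_t(b(t))$); it is not assumed to satisfy the Leibniz rule and may be, for example, a Caputo-type fractional derivative. For each $d$, $N(d)_{x_d}$ and $M(d)_{x_d}$ are linear differential operators with respect to the spatial variable $x_d$: functions not depending on $x_d$ are treated as constants by them (their coefficients may depend on the other spatial variables, as in $\frac{1}{\sinh^2\eta}\partial_\alpha$). An operator $D$ satisfies the Leibniz rule if $D(vw)=vD(w)+wD(v)$. $N(d)_{x_d}M(d)_{x_d}$ denotes composition. $L_d$ is a linear operator acting on functions of $(x_1,\dots,x_m)$, with functions of $t$ treated as constants. Functions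 are regular enough that all expressions are defined. *)

theory Defs
  imports "HOL-Analysis.Analysis" "HOL-Library.Function_Algebras"
begin

text \<open>
  Functions \<open>u(x\<^sub>1,\<dots>,x\<^sub>m,t)\<close>, with \<open>m = CARD('m) \<ge> 1\<close>. They are considered on \<open>\<Omega> \<times> T\<close>
  (\<open>\<Omega>\<close> a set of space points, \<open>T\<close> a set of times); values elsewhere are irrelevant.
  Sums and products of functions are pointwise (Function_Algebras).
\<close>

type_synonym 'm stfun = "real ^ 'm \<Rightarrow> real \<Rightarrow> real"

definition eq_on :: "(real ^ 'm) set \<Rightarrow> real set \<Rightarrow> 'm stfun \<Rightarrow> 'm stfun \<Rightarrow> bool" where
  "eq_on \<Omega> T v w \<longleftrightarrow> (\<forall>x\<in>\<Omega>. \<forall>t\<in>T. v x t = w x t)"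

definition of_coord :: "'m::finite \<Rightarrow> (real \<Rightarrow> real) \<Rightarrow> 'm stfun" where
  "of_coord d f = (\<lambda>x t. f (x $ d))"

definition of_time :: "(real \<Rightarrow> real) \<Rightarrow> 'm::finite stfun" where
  "of_time g = (\<lambda>x t. g t)"

definition indep_coord :: "(real ^ 'm) set \<Rightarrow> real set \<Rightarrow> 'm::finite \<Rightarrow> 'm stfun set" where
  "indep_coord \<Omega> T d =
     {k. \<forall>t\<in>T. \<forall>x\<in>\<Omega>. \<forall>y\<in>\<Omega>. (\<forall>j. j \<noteq> d \<longrightarrow> x $ j = y $ j) \<longrightarrow> k x t = k y t}"

definition indep_space :: "(real ^ 'm) set \<Rightarrow> real set \<Rightarrow> 'm stfun set" where
  "indep_space \<Omega> T = {k. \<forall>t\<in>T. \<forall>x\<in>\<Omega>. \<forall>y\<in>\<Omega>. k x t = k y t}"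

definition indep_time :: "(real ^ 'm) set \<Rightarrow> real set \<Rightarrow> 'm stfun set" where
  "indep_time \<Omega> T = {k. \<forall>x\<in>\<Omega>. \<forall>s\<in>T. \<forall>t\<in>T. k x s = k x t}"

text \<open>
  An operator comes with its domain, the functions regular enough for it to be applied.
  No particular form is imposed on differential operators: fractional derivatives are allowed,
  and an operator with respect to one variable is one that treats functions not depending on
  that variable as constants.
\<close>

record ('m::finite) oper =
  op_dom :: "'m stfun set"
  op_app :: "'m stfun \<Rightarrow> 'm stfun"

definition op_comp :: "'m::finite oper \<Rightarrow> 'm oper \<Rightarrow> 'm oper" where
  "op_comp N M = \<lparr>op_dom = {v \<in> op_dom M. op_app M v \<in> op_dom N},
                  op_app = (\<lambda>v. op_app N (op_app M v))\<rparr>"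

text \<open>
  Linear operator for which the functions in \<open>K\<close> are constants. The first conjunct says that
  it acts on functions on \<open>\<Omega> \<times> T\<close>. The domain need not be closed under multiplication by
  elements of \<open>K\<close>, which need not be regular.
\<close>

definition linear_op ::
  "(real ^ 'm) set \<Rightarrow> real set \<Rightarrow> 'm stfun set \<Rightarrow> 'm::finite oper \<Rightarrow> bool" where
  "linear_op \<Omega> T K D \<longleftrightarrow>
     (\<forall>v\<in>op_dom D. \<forall>w. eq_on \<Omega> T v w \<longrightarrow>
        w \<in> op_dom D \<and> eq_on \<Omega> T (op_app D v) (op_app D w)) \<and>
     0 \<in> op_dom D \<and>
     (\<forall>v\<in>op_dom D. \<forall>w\<in>op_dom D.
        v + w \<in> op_dom D \<and> eq_on \<Omega> T (op_app D (v + w)) (op_app D v + op_app D w)) \<and>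
     (\<forall>c::real. \<forall>v\<in>op_dom D. (\<lambda>x t. c * v x t) \<in> op_dom D \<and>
        eq_on \<Omega> T (op_app D (\<lambda>x t. c * v x t)) (\<lambda>x t. c * op_app D v x t)) \<and>
     (\<forall>k\<in>K. \<forall>v\<in>op_dom D. k * v \<in> op_dom D \<longrightarrow>
        eq_on \<Omega> T (op_app D (k * v)) (k * op_app D v))"

definition time_op :: "(real ^ 'm) set \<Rightarrow> real set \<Rightarrow> 'm::finite oper \<Rightarrow> bool" where
  "time_op \<Omega> T D \<longleftrightarrow> linear_op \<Omega> T (indep_time \<Omega> T) D"

definition space_op :: "(real ^ 'm) set \<Rightarrow> real set \<Rightarrow> 'm::finite oper \<Rightarrow> bool" where
  "space_op \<Omega> T D \<longleftrightarrow> linear_op \<Omega> T (indep_space \<Omega> T) D"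

definition coord_op :: "(real ^ 'm) set \<Rightarrow> real set \<Rightarrow> 'm \<Rightarrow> 'm::finite oper \<Rightarrow> bool" where
  "coord_op \<Omega> T d D \<longleftrightarrow> linear_op \<Omega> T (indep_coord \<Omega> T d) D \<and> 1 \<in> op_dom D"

definition leibniz :: "(real ^ 'm) set \<Rightarrow> real set \<Rightarrow> 'm::finite oper \<Rightarrow> bool" where
  "leibniz \<Omega> T D \<longleftrightarrow> (\<forall>v\<in>op_dom D. \<forall>w\<in>op_dom D. v * w \<in> op_dom D \<and>
     eq_on \<Omega> T (op_app D (v * w)) (v * op_app D w + w * op_app D v))"

text \<open>
  The two equations differ only in the operators applied to \<open>u L\<^sub>d(u)\<close>, here called \<open>Q\<close>:
  \<open>Q = M\<close> gives (a) and \<open>Q = N\<close> gives (b). All expressions have to be defined for a solution.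
\<close>

definition solves ::
  "(real ^ 'm) set \<Rightarrow> real set \<Rightarrow> 'm::finite oper \<Rightarrow> ('m \<Rightarrow> real \<Rightarrow> real) \<Rightarrow> ('m \<Rightarrow> 'm oper) \<Rightarrow>
   ('m \<Rightarrow> 'm oper) \<Rightarrow> ('m \<Rightarrow> 'm oper) \<Rightarrow> ('m \<Rightarrow> 'm oper) \<Rightarrow> 'm stfun \<Rightarrow> bool" where
  "solves \<Omega> T Ot A L N M Q u \<longleftrightarrow>
     u \<in> op_dom Ot \<and>
     (\<forall>d. u \<in> op_dom (L d) \<and> u * op_app (L d) u \<in> op_dom (Q d) \<and>
          u \<in> op_dom (op_comp (N d) (M d))) \<and>
     (\<forall>x\<in>\<Omega>. \<forall>t\<in>T.
        op_app Ot u x t - (\<Sum>d\<in>UNIV. A d t * op_app (Q d) (u * op_app (L d) u) x t)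
        = (\<Sum>d\<in>UNIV. op_app (op_comp (N d) (M d)) u x t) + (\<Sum>d\<in>UNIV. A d t) * u x t)"

definition separated_sum ::
  "('m::finite \<Rightarrow> nat) \<Rightarrow> ('m \<Rightarrow> nat \<Rightarrow> real \<Rightarrow> real) \<Rightarrow> ('m \<Rightarrow> nat \<Rightarrow> real \<Rightarrow> real) \<Rightarrow> 'm stfun" where
  "separated_sum m b \<omega> = (\<lambda>x t. \<Sum>d\<in>UNIV. \<Sum>l=0..m d. b d l t * \<omega> d l (x $ d))"

definition normalized ::
  "(real ^ 'm) set \<Rightarrow> real set \<Rightarrow> ('m::finite \<Rightarrow> nat) \<Rightarrow> ('m \<Rightarrow> nat \<Rightarrow> real \<Rightarrow> real) \<Rightarrow>
   ('m \<Rightarrow> 'm oper) \<Rightarrow> bool" where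
  "normalized \<Omega> T m \<omega> D \<longleftrightarrow>
     (\<forall>d. (\<forall>l\<in>{1..m d}. eq_on \<Omega> T (op_app (D d) (of_coord d (\<omega> d l))) 1) \<and>
          eq_on \<Omega> T (op_app (D d) (of_coord d (\<omega> d 0))) 0)"

text \<open>
  The standing convention that the functions are regular enough for all expressions to be
  defined: those in the hypotheses, in the equation (with \<open>Q\<close> as above), and those obtained by
  applying an operator to \<open>u\<close> term by term.
\<close>

definition regular_data ::
  "'m::finite oper \<Rightarrow> ('m \<Rightarrow> 'm oper) \<Rightarrow> ('m \<Rightarrow> 'm oper) \<Rightarrow> ('m \<Rightarrow> 'm oper) \<Rightarrow>
   ('m \<Rightarrow> 'm oper) \<Rightarrow> ('m \<Rightarrow> nat) \<Rightarrow> ('m \<Rightarrow> nat \<Rightarrow> real \<Rightarrow> real) \<Rightarrow>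
   ('m \<Rightarrow> nat \<Rightarrow> real \<Rightarrow> real) \<Rightarrow> bool" where
  "regular_data Ot L N M Q m b \<omega> \<longleftrightarrow>
     (\<forall>d. \<forall>l\<le>m d. of_time (b d l) \<in> op_dom Ot \<and>
        of_time (b d l) * of_coord d (\<omega> d l) \<in> op_dom Ot) \<and>
     (\<forall>d d'. \<forall>l\<le>m d'. of_coord d' (\<omega> d' l) \<in> op_dom (L d)) \<and>
     (\<forall>d d'. \<forall>l\<le>m d'. \<forall>D\<in>{L d, M d, Q d}.
        of_time (b d' l) * of_coord d' (\<omega> d' l) \<in> op_dom D) \<and>
     (\<forall>d. \<forall>l\<le>m d. of_coord d (\<omega> d l) \<in> op_dom (M d) \<inter> op_dom (Q d)) \<and>
     (\<forall>d. separated_sum m b \<omega> * op_app (L d) (separated_sum m b \<omega>) \<in> op_dom (Q d)) \<and>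
     (\<forall>d. op_app (M d) (separated_sum m b \<omega>) \<in> op_dom (N d))"

end

theory Submission
  imports Defs
begin

text \<open>
  Since \<open>L\<^sub>d u = \<lambda>\<^sub>d u\<close>, the Leibniz rule gives \<open>Q\<^sub>d (u L\<^sub>d u) = 2 \<lambda>\<^sub>d u Q\<^sub>d u\<close>, and normalization makes
  \<open>Q\<^sub>d u\<close> the function \<open>\<Sum>l\<ge>1. b\<^sub>d\<^sub>l\<close> of time alone. In particular \<open>M\<^sub>d u\<close> is a constant for \<open>N\<^sub>d\<close>, so the
  second-order terms vanish. Finally \<open>\<O>\<^sub>t u\<close> is \<open>u\<close> times the bracket in the system for \<open>b\<close>, and this
  bracket cancels the remaining terms.
\<close>

section \<open>Linear operators and finite sums\<close>

lemma sum_fun_apply2: "(\<Sum>i\<in>I. f i) x t = (\<Sum>i\<in>I. f i x t :: 'b::comm_monoid_add)"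
  by (induction I rule: infinite_finite_induct) simp_all

lemma linear_op_cong:
  assumes "linear_op \<Omega> T K D" "v \<in> op_dom D" "eq_on \<Omega> T v w"
  shows "w \<in> op_dom D" "eq_on \<Omega> T (op_app D v) (op_app D w)"
  using assms unfolding linear_op_def by blast+

lemma linear_op_add:
  assumes "linear_op \<Omega> T K D" "v \<in> op_dom D" "w \<in> op_dom D"
  shows "v + w \<in> op_dom D" "eq_on \<Omega> T (op_app D (v + w)) (op_app D v + op_app D w)"
  using assms unfolding linear_op_def by blast+

lemma linear_op_const_mult:
  assumes "linear_op \<Omega> T K D" "k \<in> K" "v \<in> op_dom D" "k * v \<in> op_dom D"
  shows "eq_on \<Omega> T (op_app D (k * v)) (k * op_app D v)"
  using assms unfolding linear_op_def by blast

lemma linear_op_zero: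
  assumes "linear_op \<Omega> T K D"
  shows "0 \<in> op_dom D" "eq_on \<Omega> T (op_app D 0) 0"
proof -
  show 0: "0 \<in> op_dom D"
    using assms unfolding linear_op_def by blast
  \<comment> \<open>Additivity at \<open>0 + 0\<close> says that the value equals twice itself at
    each point of \<open>\<Omega> \<times> T\<close>.\<close>
  show "eq_on \<Omega> T (op_app D 0) 0"
    using linear_op_add(2)[OF assms 0 0] by (simp add: eq_on_def)
qed

text \<open>Domain membership and additivity go through one induction: the binary law applies to the
  next summand only once the partial sum is known to lie in the domain.\<close>

lemma linear_op_sum:
  assumes "linear_op \<Omega> T K D" "finite I" "\<And>i. i \<in> I \<Longrightarrow> f i \<in> op_dom D"
  shows "(\<Sum>i\<in>I. f i) \<in> op_dom D \<and> eq_on \<Omega> T (op_app D (\<Sum>i\<in>I. f i)) (\<Sum>i\<in>I. op_app D (f i))"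
  using assms(2,3)
proof (induction I rule: finite_induct)
  case empty
  then show ?case
    using linear_op_zero[OF assms(1)] by (simp only: sum.empty)
next
  case (insert i I)
  then have "f i \<in> op_dom D" and IH: "(\<Sum>i\<in>I. f i) \<in> op_dom D"
    "eq_on \<Omega> T (op_app D (\<Sum>i\<in>I. f i)) (\<Sum>i\<in>I. op_app D (f i))"
    by auto
  note add = linear_op_add[OF assms(1) this(1,2)]
  have "eq_on \<Omega> T (op_app D (f i + (\<Sum>i\<in>I. f i))) (op_app D (f i) + (\<Sum>i\<in>I. op_app D (f i)))"
    using add(2) IH(2) unfolding eq_on_def plus_fun_apply by presburger
  with add(1) show ?case
    unfolding sum.insert[OF insert(1,2)] by (rule conjI)
qed

lemma separated_sum_eq_sum:
  "separated_sum m b \<omega> = (\<Sum>d\<in>UNIV. \<Sum>l=0..m d. of_time (b d l) * of_coord d (\<omega> d l))"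
  by (simp add: fun_eq_iff separated_sum_def sum_fun_apply2 of_time_def of_coord_def)

text \<open>Additivity is used twice: over \<open>l\<close> for fixed \<open>d\<close>, which also
  puts the inner sums into the domain, and then over \<open>d\<close>.\<close>

lemma linear_op_separated_sum:
  assumes "linear_op \<Omega> T K D"
    and "\<And>d l. l \<le> m d \<Longrightarrow> of_time (b d l) * of_coord d (\<omega> d l) \<in> op_dom D"
  shows "separated_sum m b \<omega> \<in> op_dom D"
    and "eq_on \<Omega> T (op_app D (separated_sum m b \<omega>))
           (\<Sum>d\<in>UNIV. \<Sum>l=0..m d. op_app D (of_time (b d l) * of_coord d (\<omega> d l)))"
proof -
  have "(\<Sum>l=0..m d. of_time (b d l) * of_coord d (\<omega> d l)) \<in> op_dom D \<and>
        eq_on \<Omega> T (op_app D (\<Sum>l=0..m d. of_time (b d l) * of_coord d (\<omega> d l)))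
          (\<Sum>l=0..m d. op_app D (of_time (b d l) * of_coord d (\<omega> d l)))" for d
    using assms by (intro linear_op_sum) auto
  note inner = this
  have "separated_sum m b \<omega> \<in> op_dom D \<and> eq_on \<Omega> T (op_app D (separated_sum m b \<omega>))
          (\<Sum>d\<in>UNIV. op_app D (\<Sum>l=0..m d. of_time (b d l) * of_coord d (\<omega> d l)))"
    unfolding separated_sum_eq_sum using inner by (intro linear_op_sum[OF assms(1)]) auto
  with inner show "separated_sum m b \<omega> \<in> op_dom D"
    and "eq_on \<Omega> T (op_app D (separated_sum m b \<omega>))
           (\<Sum>d\<in>UNIV. \<Sum>l=0..m d. op_app D (of_time (b d l) * of_coord d (\<omega> d l)))"
    by (auto simp: eq_on_def sum_fun_apply2)
qed

text \<open>The Leibniz rule at \<open>1 * 1\<close> gives \<open>D 1 = 2 * D 1\<close>, hence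
  \<open>D 1 = 0\<close>. Writing \<open>k\<close> as \<open>k * 1\<close> and pulling out the
  constant \<open>k\<close> leaves \<open>k * D 1 = 0\<close>.\<close>

lemma coord_op_const:
  assumes "coord_op \<Omega> T d D" "leibniz \<Omega> T D" "k \<in> indep_coord \<Omega> T d" "k \<in> op_dom D"
  shows "eq_on \<Omega> T (op_app D k) 0"
proof -
  have lin: "linear_op \<Omega> T (indep_coord \<Omega> T d) D" and one: "1 \<in> op_dom D"
    using assms(1) by (auto simp: coord_op_def)
  have "eq_on \<Omega> T (op_app D (1 * 1)) (1 * op_app D 1 + 1 * op_app D 1)"
    using assms(2) one unfolding leibniz_def by blast
  then have "eq_on \<Omega> T (op_app D 1) 0"
    by (simp add: eq_on_def)
  moreover have "eq_on \<Omega> T (op_app D (k * 1)) (k * op_app D 1)"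
    using linear_op_const_mult[OF lin assms(3) one] assms(4) by simp
  ultimately show ?thesis
    by (simp add: eq_on_def)
qed

section \<open>Constants of the operators and their action on the separated sum\<close>

lemma of_time_indep_space: "of_time g \<in> indep_space \<Omega> T"
  by (simp add: of_time_def indep_space_def)

lemma of_time_indep_coord: "of_time g \<in> indep_coord \<Omega> T d"
  by (simp add: of_time_def indep_coord_def)

lemma of_coord_indep_time: "of_coord d f \<in> indep_time \<Omega> T"
  by (simp add: of_coord_def indep_time_def)

lemma of_time_mult_of_coord_indep_coord:
  "d' \<noteq> d \<Longrightarrow> of_time g * of_coord d' f \<in> indep_coord \<Omega> T d"
  by (auto simp: of_time_def of_coord_def indep_coord_def)

text \<open>The spatial factor of each term is a constant for \<open>Ot\<close>, so no Leibniz rule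
  in time enters. The factor \<open>S\<close> is the same for all \<open>d\<close> and
  \<open>l\<close> and comes out of the double sum.\<close>

lemma time_op_separated_sum:
  assumes Ot: "time_op \<Omega> T Ot"
    and dom: "\<And>d l. l \<le> m d \<Longrightarrow> of_time (b d l) \<in> op_dom Ot"
      "\<And>d l. l \<le> m d \<Longrightarrow> of_time (b d l) * of_coord d (\<omega> d l) \<in> op_dom Ot"
    and sys: "\<And>d l x t. l \<le> m d \<Longrightarrow> x \<in> \<Omega> \<Longrightarrow> t \<in> T \<Longrightarrow>
      op_app Ot (of_time (b d l)) x t = b d l t * S t"
  shows "eq_on \<Omega> T (op_app Ot (separated_sum m b \<omega>)) (of_time S * separated_sum m b \<omega>)"
proof -
  have lin: "linear_op \<Omega> T (indep_time \<Omega> T) Ot"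
    using Ot by (simp add: time_op_def)
  have "op_app Ot (of_time (b d l) * of_coord d (\<omega> d l)) x t = S t * (b d l t * \<omega> d l (x $ d))"
    if "l \<le> m d" "x \<in> \<Omega>" "t \<in> T" for d l x t
    using linear_op_const_mult[OF lin of_coord_indep_time dom(1)[OF that(1)], of d "\<omega> d l"]
      dom(2)[OF that(1)] sys[OF that] that
    by (simp add: eq_on_def mult.commute of_coord_def)
  then show ?thesis
    using linear_op_separated_sum(2)[where b = b and m = m and \<omega> = \<omega>, OF lin dom(2)]
    by (simp add: eq_on_def sum_fun_apply2 of_time_def separated_sum_def sum_distrib_left)
qed

text \<open>The coefficients \<open>b d l\<close> are constants for \<open>L\<close>, and all
  spatial factors share the eigenvalue \<open>lam\<close>; hence so does their combination.\<close>

lemma space_op_separated_sum: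
  assumes L: "space_op \<Omega> T L"
    and dom: "\<And>d l. l \<le> m d \<Longrightarrow> of_coord d (\<omega> d l) \<in> op_dom L"
      "\<And>d l. l \<le> m d \<Longrightarrow> of_time (b d l) * of_coord d (\<omega> d l) \<in> op_dom L"
    and eigen: "\<And>d l. l \<le> m d \<Longrightarrow>
      eq_on \<Omega> T (op_app L (of_coord d (\<omega> d l))) (of_time lam * of_coord d (\<omega> d l))"
  shows "eq_on \<Omega> T (op_app L (separated_sum m b \<omega>)) (of_time lam * separated_sum m b \<omega>)"
proof -
  have lin: "linear_op \<Omega> T (indep_space \<Omega> T) L"
    using L by (simp add: space_op_def)
  have "op_app L (of_time (b d l) * of_coord d (\<omega> d l)) x t = lam t * (b d l t * \<omega> d l (x $ d))"
    if "l \<le> m d" "x \<in> \<Omega>" "t \<in> T" for d l x t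
    using linear_op_const_mult[OF lin of_time_indep_space dom(1)[OF that(1)], of "b d l"]
      dom(2)[OF that(1)] eigen[OF that(1)] that
    by (simp add: eq_on_def of_coord_def of_time_def)
  then show ?thesis
    using linear_op_separated_sum(2)[where b = b and m = m and \<omega> = \<omega>, OF lin dom(2)]
    by (simp add: eq_on_def sum_fun_apply2 of_time_def separated_sum_def sum_distrib_left)
qed

text \<open>Only the terms in the coordinate \<open>d\<close> itself survive; there normalization
  replaces each spatial factor by 1, or by 0 if \<open>l = 0\<close>. What remains depends on time
  alone.\<close>

lemma coord_op_separated_sum:
  assumes D: "coord_op \<Omega> T d (D d)" "leibniz \<Omega> T (D d)" "normalized \<Omega> T m \<omega> D"
    and dom: "\<And>l. l \<le> m d \<Longrightarrow> of_coord d (\<omega> d l) \<in> op_dom (D d)"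
      "\<And>d' l. l \<le> m d' \<Longrightarrow> of_time (b d' l) * of_coord d' (\<omega> d' l) \<in> op_dom (D d)"
  shows "eq_on \<Omega> T (op_app (D d) (separated_sum m b \<omega>)) (of_time (\<lambda>t. \<Sum>l=1..m d. b d l t))"
  unfolding eq_on_def
proof (intro ballI)
  fix x t assume xt: "x \<in> \<Omega>" "t \<in> T"
  have lin: "linear_op \<Omega> T (indep_coord \<Omega> T d) (D d)"
    using D(1) by (simp add: coord_op_def)
  let ?w = "\<lambda>d' l. of_time (b d' l) * of_coord d' (\<omega> d' l)"
  \<comment> \<open>A term in another coordinate is, as a whole product, a constant for
    \<open>D d\<close>, so it is not split into its factors.\<close>
  have other: "op_app (D d) (?w d' l) x t = 0" if "l \<le> m d'" "d' \<noteq> d" for d' l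
    using coord_op_const[OF D(1,2) of_time_mult_of_coord_indep_coord[OF that(2)] dom(2)[OF that(1)]]
      xt by (simp add: eq_on_def)
  have same: "op_app (D d) (?w d l) x t = (if l = 0 then 0 else b d l t)" if "l \<le> m d" for l
  proof -
    have "op_app (D d) (?w d l) x t = b d l t * op_app (D d) (of_coord d (\<omega> d l)) x t"
      using linear_op_const_mult[OF lin of_time_indep_coord dom(1)[OF that] dom(2)[OF that]] xt
      by (simp add: eq_on_def of_time_def)
    moreover have "op_app (D d) (of_coord d (\<omega> d l)) x t = (if l = 0 then 0 else 1)"
      using D(3) that xt by (cases "l = 0") (auto simp: normalized_def eq_on_def)
    ultimately show ?thesis
      by simp
  qed
  have "op_app (D d) (separated_sum m b \<omega>) x t = (\<Sum>d'\<in>UNIV. \<Sum>l=0..m d'. op_app (D d) (?w d' l) x t)"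
    using linear_op_separated_sum(2)[where b = b and m = m and \<omega> = \<omega>, OF lin dom(2)] xt
    by (simp add: eq_on_def sum_fun_apply2)
  also have "\<dots> = (\<Sum>l=0..m d. op_app (D d) (?w d l) x t)"
    by (subst sum.remove[of _ d]) (auto intro!: sum.neutral simp: other)
  \<comment> \<open>The term \<open>l = 0\<close> is split off and vanishes by \<open>same\<close>;
    this is why the sum starts at 1.\<close>
  also have "\<dots> = (\<Sum>l=1..m d. b d l t)"
    by (simp add: sum.atLeast_Suc_atMost same)
  finally show "op_app (D d) (separated_sum m b \<omega>) x t = of_time (\<lambda>t. \<Sum>l=1..m d. b d l t) x t"
    by (simp add: of_time_def)
qed

text \<open>On \<open>\<Omega> \<times> T\<close> the product \<open>u * v\<close> is
  \<open>g\<close> times the square of \<open>u\<close>. The time factor comes out, and the Leibniz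
  rule for the square gives the factor 2.\<close>

lemma leibniz_square:
  assumes Q: "linear_op \<Omega> T (indep_coord \<Omega> T d) Q" "leibniz \<Omega> T Q"
    and dom: "u \<in> op_dom Q" "u * v \<in> op_dom Q"
    and v: "eq_on \<Omega> T v (of_time g * u)"
  shows "eq_on \<Omega> T (op_app Q (u * v)) (2 * of_time g * u * op_app Q u)"
proof -
  have sq: "u * u \<in> op_dom Q" "eq_on \<Omega> T (op_app Q (u * u)) (u * op_app Q u + u * op_app Q u)"
    using Q(2) dom(1) unfolding leibniz_def by blast+
  have uv: "eq_on \<Omega> T (u * v) (of_time g * (u * u))"
    using v by (simp add: eq_on_def)
  \<comment> \<open>The congruence also puts \<open>of_time g * (u * u)\<close> into the domain, so
    no regularity of \<open>g\<close> itself is required.\<close>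
  note cong = linear_op_cong[OF Q(1) dom(2) uv]
  have "eq_on \<Omega> T (op_app Q (of_time g * (u * u))) (of_time g * op_app Q (u * u))"
    using linear_op_const_mult[OF Q(1) of_time_indep_coord sq(1) cong(1)] .
  then show ?thesis
    using cong(2) sq(2) by (simp add: eq_on_def)
qed

section \<open>Both equations at once, with a general operator \<open>Q\<close>\<close>

lemma solves_separated_sum:
  fixes \<Omega> :: "(real ^ 'm::finite) set"
    and A lam :: "'m \<Rightarrow> real \<Rightarrow> real" and b :: "'m \<Rightarrow> nat \<Rightarrow> real \<Rightarrow> real"
  assumes Ot: "time_op \<Omega> T Ot"
    and L: "\<And>d. space_op \<Omega> T (L d)"
    and N: "\<And>d. coord_op \<Omega> T d (N d)" "\<And>d. leibniz \<Omega> T (N d)"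
    and M: "\<And>d. coord_op \<Omega> T d (M d)" "\<And>d. leibniz \<Omega> T (M d)" "normalized \<Omega> T m \<omega> M"
    and Q: "\<And>d. coord_op \<Omega> T d (Q d)" "\<And>d. leibniz \<Omega> T (Q d)" "normalized \<Omega> T m \<omega> Q"
    and eigen: "\<And>d d' l. l \<le> m d' \<Longrightarrow>
       eq_on \<Omega> T (op_app (L d) (of_coord d' (\<omega> d' l))) (of_time (lam d) * of_coord d' (\<omega> d' l))"
    and sys: "\<And>d l x t. l \<le> m d \<Longrightarrow> x \<in> \<Omega> \<Longrightarrow> t \<in> T \<Longrightarrow>
       op_app Ot (of_time (b d l)) x t
       = b d l t * ((\<Sum>d'\<in>UNIV. 2 * A d' t * lam d' t * (\<Sum>l'=1..m d'. b d' l' t))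
                    + (\<Sum>d'\<in>UNIV. A d' t))"
    and reg: "regular_data Ot L N M Q m b \<omega>"
  shows "solves \<Omega> T Ot A L N M Q (separated_sum m b \<omega>)"
proof -
  define u where "u = separated_sum m b \<omega>"
  define B where "B = (\<lambda>d t. \<Sum>l=1..m d. b d l t)"
  \<comment> \<open>\<open>S\<close> is the bracket in the system for \<open>b\<close>, so
    \<open>Ot\<close> acts on \<open>u\<close> as multiplication by \<open>S\<close>.\<close>
  define S where "S = (\<lambda>t. (\<Sum>d\<in>UNIV. 2 * A d t * lam d t * B d t) + (\<Sum>d\<in>UNIV. A d t))"
  have linear: "linear_op \<Omega> T (indep_time \<Omega> T) Ot" "linear_op \<Omega> T (indep_space \<Omega> T) (L d)"
    "linear_op \<Omega> T (indep_coord \<Omega> T d) (N d)" "linear_op \<Omega> T (indep_coord \<Omega> T d) (M d)"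
    "linear_op \<Omega> T (indep_coord \<Omega> T d) (Q d)" for d
    using Ot L N(1) M(1) Q(1) by (auto simp: time_op_def space_op_def coord_op_def)
  have factor_dom: "of_time (b d l) \<in> op_dom Ot" "of_coord d (\<omega> d l) \<in> op_dom (L d')"
    "of_coord d (\<omega> d l) \<in> op_dom (M d)" "of_coord d (\<omega> d l) \<in> op_dom (Q d)"
    if "l \<le> m d" for d d' l
    using reg that by (auto simp: regular_data_def)
  have term_dom: "of_time (b d l) * of_coord d (\<omega> d l) \<in> op_dom Ot"
    "of_time (b d l) * of_coord d (\<omega> d l) \<in> op_dom (L d')"
    "of_time (b d l) * of_coord d (\<omega> d l) \<in> op_dom (M d')"
    "of_time (b d l) * of_coord d (\<omega> d l) \<in> op_dom (Q d')"
    if "l \<le> m d" for d d' l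
    using reg that by (auto simp: regular_data_def)
  have u_dom: "u \<in> op_dom Ot" "u \<in> op_dom (L d)" "u \<in> op_dom (Q d)"
    "u * op_app (L d) u \<in> op_dom (Q d)" "u \<in> op_dom (M d)" "op_app (M d) u \<in> op_dom (N d)" for d
    using reg unfolding u_def regular_data_def
    by (auto intro: linear_op_separated_sum(1)[OF linear(1) term_dom(1)]
        linear_op_separated_sum(1)[OF linear(2) term_dom(2)]
        linear_op_separated_sum(1)[OF linear(4) term_dom(3)]
        linear_op_separated_sum(1)[OF linear(5) term_dom(4)])
  have Ot_u: "eq_on \<Omega> T (op_app Ot u) (of_time S * u)"
    unfolding u_def S_def B_def
    by (intro time_op_separated_sum Ot factor_dom term_dom) (simp_all add: sys)
  have Lu: "eq_on \<Omega> T (op_app (L d) u) (of_time (lam d) * u)" for d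
    unfolding u_def by (intro space_op_separated_sum L factor_dom term_dom eigen)
  have Mu: "eq_on \<Omega> T (op_app (M d) u) (of_time (B d))" for d
    unfolding u_def B_def by (intro coord_op_separated_sum M factor_dom term_dom)
  have Qu: "eq_on \<Omega> T (op_app (Q d) u) (of_time (B d))" for d
    unfolding u_def B_def by (intro coord_op_separated_sum Q factor_dom term_dom)
  have NMu: "eq_on \<Omega> T (op_app (N d) (op_app (M d) u)) 0" for d
    \<comment> \<open>\<open>M d\<close> applied to \<open>u\<close> agrees with
      \<open>of_time (B d)\<close> on \<open>\<Omega> \<times> T\<close>. Congruence moves the
      latter into the domain of \<open>N d\<close>, where it is a constant and is
      annihilated.\<close>
    using linear_op_cong[OF linear(3) u_dom(6) Mu]
      coord_op_const[where d = d and k = "of_time (B d)", OF N of_time_indep_coord]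
    by (simp add: eq_on_def)
  have QuLu: "eq_on \<Omega> T (op_app (Q d) (u * op_app (L d) u)) (of_time (\<lambda>t. 2 * lam d t * B d t) * u)" for d
    using leibniz_square[OF linear(5) Q(2) u_dom(3,4) Lu] Qu[of d]
    by (simp add: eq_on_def of_time_def)
  have "op_app Ot u x t - (\<Sum>d\<in>UNIV. A d t * op_app (Q d) (u * op_app (L d) u) x t)
        = (\<Sum>d\<in>UNIV. op_app (op_comp (N d) (M d)) u x t) + (\<Sum>d\<in>UNIV. A d t) * u x t"
    if "x \<in> \<Omega>" "t \<in> T" for x t
    \<comment> \<open>After substitution the left side is \<open>S\<close> times \<open>u\<close>
      minus the sum of \<open>2 * A * lam * B * u\<close>, which leaves the sum of the
      \<open>A\<close> times \<open>u\<close>; the second-order sum on the right is 0.\<close>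
    using that Ot_u NMu QuLu
    by (simp add: eq_on_def op_comp_def of_time_def S_def algebra_simps sum_distrib_left)
  then show ?thesis
    using u_dom unfolding solves_def u_def[symmetric] by (auto simp: op_comp_def)
qed

theorem proposition4p1:
  fixes \<Omega> :: "(real ^ 'm::finite) set" and T :: "real set"
    and Ot :: "'m oper"
    and N M L :: "'m \<Rightarrow> 'm oper"
    and A lam :: "'m \<Rightarrow> real \<Rightarrow> real"
    and m :: "'m \<Rightarrow> nat"
    and \<omega> b :: "'m \<Rightarrow> nat \<Rightarrow> real \<Rightarrow> real"
  assumes m_pos: "\<And>d. m d > 0"
    and Ot: "time_op \<Omega> T Ot"
    and L: "\<And>d. space_op \<Omega> T (L d)"
    and N: "\<And>d. coord_op \<Omega> T d (N d)"
    and M: "\<And>d. coord_op \<Omega> T d (M d)"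
    and leibniz_N: "\<And>d. leibniz \<Omega> T (N d)"
    and leibniz_M: "\<And>d. leibniz \<Omega> T (M d)"
    and eigen: "\<And>d d' l. l \<le> m d' \<Longrightarrow>
       eq_on \<Omega> T (op_app (L d) (of_coord d' (\<omega> d' l))) (of_time (lam d) * of_coord d' (\<omega> d' l))"
    and sys: "\<And>d l x t. l \<le> m d \<Longrightarrow> x \<in> \<Omega> \<Longrightarrow> t \<in> T \<Longrightarrow>
       op_app Ot (of_time (b d l)) x t
       = b d l t * ((\<Sum>d'\<in>UNIV. 2 * A d' t * lam d' t * (\<Sum>l'=1..m d'. b d' l' t))
                    + (\<Sum>d'\<in>UNIV. A d' t))"
  shows "(normalized \<Omega> T m \<omega> M \<and> regular_data Ot L N M M m b \<omega>
            \<longrightarrow> solves \<Omega> T Ot A L N M M (separated_sum m b \<omega>))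
       \<and> (normalized \<Omega> T m \<omega> N \<and> normalized \<Omega> T m \<omega> M \<and> regular_data Ot L N M N m b \<omega>
            \<longrightarrow> solves \<Omega> T Ot A L N M N (separated_sum m b \<omega>))"
\<comment> \<open>Equation (a) is the instance \<open>Q = M\<close>, where one normalization serves
  both roles. Equation (b) is \<open>Q = N\<close>: normalization of \<open>N\<close> evaluates the
  quadratic term, that of \<open>M\<close> makes the second-order terms vanish.\<close>
proof (intro conjI impI; elim conjE)
  assume "normalized \<Omega> T m \<omega> M" "regular_data Ot L N M M m b \<omega>"
  then show "solves \<Omega> T Ot A L N M M (separated_sum m b \<omega>)"
    by (intro solves_separated_sum[where lam = lam] Ot L N M leibniz_N leibniz_M eigen sys)
next
  assume "normalized \<Omega> T m \<omega> N" "normalized \<Omega> T m \<omega> M" "regular_data Ot L N M N m b \<omega>"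
  then show "solves \<Omega> T Ot A L N M N (separated_sum m b \<omega>)"
    by (intro solves_separated_sum[where lam = lam] Ot L N M leibniz_N leibniz_M eigen sys)
qed

end
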